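(* Let $\sigma$ be an endomorphism of a commutative algebra $\mathcal{A}$, and let $\Delta$ be a $\sigma$-derivation of $\mathcal{A}$. Let $a,b\in\mathcal{A}$ be such that $a\Delta=p(\mathrm{id}-\sigma)$ and $b\Delta=q(\mathrm{id}-\sigma)$ are inner, where $p,q\in\mathcal{A}$. Then $[a\Delta,b\Delta]_{\sigma}$ is inner. More precisely, $$[a\Delta,b\Delta]_{\sigma}=c(\mathrm{id}-\sigma),\qquad c=\Delta(b)p-\Delta(a)q,$$ and so $[a\Delta,b\Delta]_{\sigma}=(\Delta(b)a-\Delta(a)b)\Delta$.
   Context: Algebras are associative unital $\mathbb{C}$-algebras, and endomorphisms are unital $\mathbb{C}$-algebra endomorphisms. A $\sigma$-derivation of $\mathcal{A}$ is a $\mathbb{C}$-linear map $D:\mathcal{A}\to\mathcal{A}$ with $D(ab)=\sigma(a)D(b)+D(a)b$ for all $a,b\in\mathcal{A}$. For $\mathcal{A}$ commutative, the $\sigma$-derivations form a left $\mathcal{A}$-module via $(a\Delta)(r)=a\Delta(r)$. A $\sigma$-derivation is called inner if it is of the form $p(\mathrm{id}-\sigma): r\mapsto p(r-\sigma(r))$ for some $p\in\mathcal{A}$. For $a,b\in\mathcal{A}$ the bracket is $$[a\Delta,b\Delta]_\sigma=(\sigma(a)\Delta)\circ(b\Delta)-(\sigma(b)\Delta)\circ(a\Delta),$$ with $\circ$ composition of maps, which equals $\big(\sigma(a)\Delta(b)-\sigma(b)\Delta(a)\big)\Delta$. (It is a well-defined product on $\mathcal{A}\Delta$, independent of the chosen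 coefficients $a,b$, when $\sigma(\mathrm{Ann}(\Delta))\subseteq \mathrm{Ann}(\Delta)$, where $\mathrm{Ann}(\Delta)=\{x\in\mathcal{A} : x\Delta(y)=0\ \forall y\in\mathcal{A}\}$; in this statement the bracket is taken with the given coefficients $a,b$.) *)

theory Defs
  imports Complex_Main
begin

text \<open>
  The sort \<open>{ring, monoid_mult}\<close> is that of unital associative rings; unlike \<open>ring_1\<close> it
  does not exclude the zero ring.
\<close>

locale complex_algebra = vector_space scale
  for scale :: "complex \<Rightarrow> 'a::{ring, monoid_mult} \<Rightarrow> 'a" +
  assumes scale_mult_left: "scale c x * y = scale c (x * y)"
    and scale_mult_right: "x * scale c y = scale c (x * y)"

definition algebra_endomorphism ::
    "(complex \<Rightarrow> 'a::{ring, monoid_mult} \<Rightarrow> 'a) \<Rightarrow> ('a \<Rightarrow> 'a) \<Rightarrow> bool" where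
  "algebra_endomorphism scale \<sigma> \<longleftrightarrow>
     Vector_Spaces.linear scale scale \<sigma> \<and> \<sigma> 1 = 1 \<and> (\<forall>x y. \<sigma> (x * y) = \<sigma> x * \<sigma> y)"

definition sigma_derivation ::
    "(complex \<Rightarrow> 'a::{ring, monoid_mult} \<Rightarrow> 'a) \<Rightarrow> ('a \<Rightarrow> 'a) \<Rightarrow> ('a \<Rightarrow> 'a) \<Rightarrow> bool" where
  "sigma_derivation scale \<sigma> D \<longleftrightarrow>
     Vector_Spaces.linear scale scale D \<and> (\<forall>x y. D (x * y) = \<sigma> x * D y + D x * y)"

definition left_mult :: "'a::{ring, monoid_mult} \<Rightarrow> ('a \<Rightarrow> 'a) \<Rightarrow> 'a \<Rightarrow> 'a" where
  "left_mult a D = (\<lambda>r. a * D r)"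

definition id_minus :: "('a::{ring, monoid_mult} \<Rightarrow> 'a) \<Rightarrow> 'a \<Rightarrow> 'a" where
  "id_minus \<sigma> = (\<lambda>r. r - \<sigma> r)"

definition inner_sigma_derivation ::
    "(complex \<Rightarrow> 'a::{ring, monoid_mult} \<Rightarrow> 'a) \<Rightarrow> ('a \<Rightarrow> 'a) \<Rightarrow> ('a \<Rightarrow> 'a) \<Rightarrow> bool" where
  "inner_sigma_derivation scale \<sigma> D \<longleftrightarrow>
     sigma_derivation scale \<sigma> D \<and> (\<exists>p. D = left_mult p (id_minus \<sigma>))"

text \<open>
  \<open>sigma_bracket \<sigma> \<Delta> a b\<close> is the bracket \<open>[a\<Delta>, b\<Delta>]\<^sub>\<sigma>\<close>. It is a function of the coefficients
  \<open>a\<close> and \<open>b\<close>, not just of the maps \<open>a\<Delta>\<close> and \<open>b\<Delta>\<close>: it is independent of the choice of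
  coefficients only if \<open>\<sigma>\<close> preserves the annihilator of \<open>\<Delta>\<close>, which is not assumed.
\<close>

definition sigma_bracket ::
    "('a::{ring, monoid_mult} \<Rightarrow> 'a) \<Rightarrow> ('a \<Rightarrow> 'a) \<Rightarrow> 'a \<Rightarrow> 'a \<Rightarrow> 'a \<Rightarrow> 'a" where
  "sigma_bracket \<sigma> \<Delta> a b =
     (\<lambda>r. (left_mult (\<sigma> a) \<Delta> \<circ> left_mult b \<Delta>) r - (left_mult (\<sigma> b) \<Delta> \<circ> left_mult a \<Delta>) r)"

end

theory Submission imports Defs begin

text \<open>
  In the bracket the second-order terms \<open>\<sigma>(a)\<sigma>(b)\<Delta>\<^sup>2\<close> cancel, leaving \<open>(\<sigma>(a)\<Delta>(b) - \<sigma>(b)\<Delta>(a))\<Delta>\<close>.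
  Expanding \<open>\<Delta>(ab) = \<Delta>(ba)\<close> with the twisted Leibniz rule on both sides shows that this
  coefficient is \<open>\<Delta>(b)a - \<Delta>(a)b\<close>, with \<open>\<sigma>\<close> no longer applied to \<open>a\<close> and \<open>b\<close>
  (\<open>sigma_bracket_untwisted\<close>). The coefficient is thus a combination of \<open>a\<close> and \<open>b\<close> themselves,
  and substituting \<open>a\<Delta> = p(id - \<sigma>)\<close> and \<open>b\<Delta> = q(id - \<sigma>)\<close> gives the inner form.
  The bracket is a \<open>\<sigma>\<close>-derivation because it is a multiple of \<open>\<Delta>\<close>.
\<close>

lemma sigma_derivation_left_mult:
  fixes scale :: "complex \<Rightarrow> 'a::{comm_ring, comm_monoid_mult} \<Rightarrow> 'a"
  assumes "complex_algebra scale" and "sigma_derivation scale \<sigma> D"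
  shows "sigma_derivation scale \<sigma> (left_mult c D)"
proof -
  interpret complex_algebra scale by fact
  have "Vector_Spaces.linear scale scale D"
    using assms(2) by (simp add: sigma_derivation_def)
  then interpret D: Vector_Spaces.linear scale scale D .
  have leibniz: "D (x * y) = \<sigma> x * D y + D x * y" for x y
    using assms(2) by (simp add: sigma_derivation_def)
  have "Vector_Spaces.linear scale scale (left_mult c D)"
    by unfold_locales
      (simp_all add: left_mult_def D.add D.scale distrib_left scale_mult_right)
  then show ?thesis
    by (simp add: sigma_derivation_def left_mult_def leibniz algebra_simps)
qed

text \<open>
  Commutativity of the algebra is used twice: to cancel the terms in \<open>\<Delta> (\<Delta> r)\<close>, and to compare
  the two expansions of \<open>\<Delta> (a * b)\<close>.
\<close>

lemma sigma_bracket_untwisted: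
  fixes \<Delta> :: "'a::{comm_ring, comm_monoid_mult} \<Rightarrow> 'a"
  assumes "sigma_derivation scale \<sigma> \<Delta>"
  shows "sigma_bracket \<sigma> \<Delta> a b = left_mult (\<Delta> b * a - \<Delta> a * b) \<Delta>"
proof
  fix r
  have leibniz: "\<Delta> (x * y) = \<sigma> x * \<Delta> y + \<Delta> x * y" for x y
    using assms by (simp add: sigma_derivation_def)
  have "\<sigma> a * \<Delta> b + \<Delta> a * b = \<sigma> b * \<Delta> a + \<Delta> b * a"
    using leibniz[of a b] leibniz[of b a] by (simp add: mult.commute)
  then have coefficient: "\<sigma> a * \<Delta> b - \<sigma> b * \<Delta> a = \<Delta> b * a - \<Delta> a * b"
    by (simp add: algebra_simps)
  have "sigma_bracket \<sigma> \<Delta> a b r = (\<sigma> a * \<Delta> b - \<sigma> b * \<Delta> a) * \<Delta> r"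
    by (simp add: sigma_bracket_def left_mult_def leibniz algebra_simps)
  then show "sigma_bracket \<sigma> \<Delta> a b r = left_mult (\<Delta> b * a - \<Delta> a * b) \<Delta> r"
    by (simp add: coefficient left_mult_def)
qed

theorem proposition2p3p1:
  fixes scale :: "complex \<Rightarrow> 'a::{comm_ring, comm_monoid_mult} \<Rightarrow> 'a"
    and \<sigma> \<Delta> :: "'a \<Rightarrow> 'a" and a b p q :: 'a
  assumes "complex_algebra scale"
    and "algebra_endomorphism scale \<sigma>"
    and "sigma_derivation scale \<sigma> \<Delta>"
    and "left_mult a \<Delta> = left_mult p (id_minus \<sigma>)"
    and "left_mult b \<Delta> = left_mult q (id_minus \<sigma>)"
  shows "inner_sigma_derivation scale \<sigma> (sigma_bracket \<sigma> \<Delta> a b)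
    \<and> sigma_bracket \<sigma> \<Delta> a b = left_mult (\<Delta> b * p - \<Delta> a * q) (id_minus \<sigma>)
    \<and> sigma_bracket \<sigma> \<Delta> a b = left_mult (\<Delta> b * a - \<Delta> a * b) \<Delta>"
proof -
  note untwisted = sigma_bracket_untwisted[OF assms(3), of a b]
  have inner: "sigma_bracket \<sigma> \<Delta> a b = left_mult (\<Delta> b * p - \<Delta> a * q) (id_minus \<sigma>)"
  proof
    fix r
    have a: "a * \<Delta> r = p * id_minus \<sigma> r"
      using fun_cong[OF assms(4), of r] by (simp add: left_mult_def)
    have b: "b * \<Delta> r = q * id_minus \<sigma> r"
      using fun_cong[OF assms(5), of r] by (simp add: left_mult_def)
    have "sigma_bracket \<sigma> \<Delta> a b r = \<Delta> b * (a * \<Delta> r) - \<Delta> a * (b * \<Delta> r)"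
      by (simp add: untwisted left_mult_def left_diff_distrib mult.assoc)
    also have "\<dots> = left_mult (\<Delta> b * p - \<Delta> a * q) (id_minus \<sigma>) r"
      unfolding a b by (simp add: left_mult_def left_diff_distrib mult.assoc)
    finally show "sigma_bracket \<sigma> \<Delta> a b r = left_mult (\<Delta> b * p - \<Delta> a * q) (id_minus \<sigma>) r" .
  qed
  have "sigma_derivation scale \<sigma> (sigma_bracket \<sigma> \<Delta> a b)"
    unfolding untwisted by (rule sigma_derivation_left_mult[OF assms(1,3)])
  with inner have "inner_sigma_derivation scale \<sigma> (sigma_bracket \<sigma> \<Delta> a b)"
    unfolding inner_sigma_derivation_def by blast
  with inner untwisted show ?thesis by blast
qed

end
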